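(* Consider the single decision maker setting described in the context, where the decision maker uses the ranking selection rule. Suppose: (H1) $\mathcal{E}_t=\boldsymbol{\mathcal{E}}$ for all rounds $t$, for a fixed matrix $\boldsymbol{\mathcal{E}}\in\mathbb{R}^{m\times d}$; (H2) $\gamma_t=\gamma$ for all rounds $t$, for a constant $\gamma\ge0$. If there is a pair of rounds $t$ and $t'$ such that $\boldsymbol{\theta}_t=k\boldsymbol{\theta}_{t'}$ for some $k>0$, then $$\mathbb{E}[Y_t\mid W_t=1;\boldsymbol{\theta}_t]-\mathbb{E}[Y_{t'}\mid W_{t'}=1;\boldsymbol{\theta}_{t'}]=\Big(\mathbb{E}[X_t\mid W_t=1;\boldsymbol{\theta}_t]-\mathbb{E}[X_{t'}\mid W_{t'}=1;\boldsymbol{\theta}_{t'}]\Big)^\top\boldsymbol{\theta}^*.$$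
   Context: Single decision maker (DM) setting. In each round $t$ the DM publishes a parameter vector $\boldsymbol{\theta}_t\in\mathbb{R}^m$ and a selection rule $\boldsymbol{\delta}_{\boldsymbol{\theta}_t}:\mathbb{R}^m\to[0,1]$. An agent arrives with random baseline $B_t\in\mathbb{R}^m$, effort conversion matrix $\mathcal{E}_t\in\mathbb{R}^{m\times d}$ and real-valued noise $O_t$ (possibly correlated with $B_t$); the joint law of $(B_t,O_t)$ is the same in every round, with finite expectations, and does not depend on the published parameters. If the agent takes action $\mathbf{a}\in\mathbb{R}^d$, its covariates are $X_t=B_t+\mathcal{E}_t\mathbf{a}$ and its predicted outcome is $\hat y_t=X_t^\top\boldsymbol{\theta}_t$. The agent chooses the action maximising $\gamma_t\hat y_t-\frac12\|\mathbf{a}\|_2^2$ (with $\gamma_t\ge0$), i.e. $\mathbf{a}_t=\gamma_t\mathcal{E}_t^\top\boldsymbol{\theta}_t$, so $X_t=B_t+\gamma_t\mathcal{E}_t\mathcal{E}_t^\top\boldsymbol{\theta}_t$. The selection status $W_t\in\{0,1\}$ satisfies $W_t\sim\mathrm{Bernoulli}(\boldsymbol{\delta}_{\boldsymbol{\theta}_t}(X_t))$ conditionally on $X_t$, independently of $(B_t,O_t)$ given $X_t$; selected agents comply. The outcome is $Y_t=X_t^\top\boldsymbol{\theta}^*+O_t$, where $\boldsymbol{\theta}^*\in\mathbb{R}^m$ is a fixed true causal parameter. The notation "$;\boldsymbol{\theta}_t$" indicates that the distribution is the one induced by deploying $\boldsymbol{\theta}_t$. Ranking selection rule: $\boldsymbol{\delta}_{\boldsymbol{\theta}_t}(\mathbf{x})=p\big(X_t^\top\boldsymbol{\theta}_t\le\mathbf{x}^\top\boldsymbol{\theta}_t\big)$,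 the cumulative distribution function of the random variable $X_t^\top\boldsymbol{\theta}_t$ (under deployment of $\boldsymbol{\theta}_t$) evaluated at $\mathbf{x}^\top\boldsymbol{\theta}_t$. *)

theory Defs
  imports "HOL-Probability.Probability"
begin

definition generated_by :: "'a measure \<Rightarrow> ('a \<Rightarrow> 'b::topological_space) \<Rightarrow> 'a measure" where
  "generated_by N X = vimage_algebra (space N) X borel"

definition cond_indep_var ::
  "'a measure \<Rightarrow> 'a measure \<Rightarrow> 'b measure \<Rightarrow> ('a \<Rightarrow> 'b) \<Rightarrow> 'c measure \<Rightarrow> ('a \<Rightarrow> 'c) \<Rightarrow> bool" where
  "cond_indep_var N F S U T V \<longleftrightarrow>
     U \<in> measurable N S \<and> V \<in> measurable N T \<and>
     (\<forall>A\<in>sets S. \<forall>C\<in>sets T. AE \<omega> in N.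
        real_cond_exp N F (\<lambda>\<omega>. indicator A (U \<omega>) * indicator C (V \<omega>)) \<omega> =
        real_cond_exp N F (\<lambda>\<omega>. indicator A (U \<omega>)) \<omega> *
        real_cond_exp N F (\<lambda>\<omega>. indicator C (V \<omega>)) \<omega>)"

text \<open>The conditional expectation of \<open>f\<close> given an event \<open>A\<close> of positive probability.\<close>

definition mean_given ::
  "'a measure \<Rightarrow> ('a \<Rightarrow> 'b::{banach,second_countable_topology}) \<Rightarrow> 'a set \<Rightarrow> 'b" where
  "mean_given N f A = integral\<^sup>L (uniform_measure N A) f"

definition agent_payoff ::
  "real ^ 'm \<Rightarrow> real ^ 'd ^ 'm \<Rightarrow> real \<Rightarrow> real ^ 'm \<Rightarrow> real ^ 'd \<Rightarrow> real" where
  "agent_payoff b \<E> \<gamma> \<theta> a = \<gamma> * ((b + \<E> *v a) \<bullet> \<theta>) - (1/2) * (norm a)\<^sup>2"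

text \<open>
  \<open>M t\<close> is the probability space of round \<open>t\<close>, that is, the law induced by deploying
  \<open>\<theta> t\<close> together with the selection rule \<open>\<delta> t\<close>. No relation between different rounds is
  imposed, except that the law of the pair (baseline, noise) is the same in all of them.
  The best-responding action is required to be a maximiser of the payoff; lemma
  \<open>agent_best_response_iff\<close> below gives it in closed form.
\<close>

locale strategic_selection =
  fixes M :: "nat \<Rightarrow> 'a measure"
    and \<theta> :: "nat \<Rightarrow> real ^ 'm"
    and \<delta> :: "nat \<Rightarrow> real ^ 'm \<Rightarrow> real"
    and B :: "nat \<Rightarrow> 'a \<Rightarrow> real ^ 'm"
    and \<E> :: "nat \<Rightarrow> real ^ 'd ^ 'm"
    and Noise :: "nat \<Rightarrow> 'a \<Rightarrow> real"
    and \<gamma> :: "nat \<Rightarrow> real"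
    and act :: "nat \<Rightarrow> 'a \<Rightarrow> real ^ 'd"
    and X :: "nat \<Rightarrow> 'a \<Rightarrow> real ^ 'm"
    and W :: "nat \<Rightarrow> 'a \<Rightarrow> nat"
    and Y :: "nat \<Rightarrow> 'a \<Rightarrow> real"
    and \<theta>star :: "real ^ 'm"
  assumes prob_space: "\<And>t. prob_space (M t)"
    and integrable_baseline: "\<And>t. integrable (M t) (B t)"
    and integrable_noise: "\<And>t. integrable (M t) (Noise t)"
    and same_law: "\<And>s t.
          distr (M s) (borel \<Otimes>\<^sub>M borel) (\<lambda>\<omega>. (B s \<omega>, Noise s \<omega>)) =
          distr (M t) (borel \<Otimes>\<^sub>M borel) (\<lambda>\<omega>. (B t \<omega>, Noise t \<omega>))"
    and gamma_nonneg: "\<And>t. 0 \<le> \<gamma> t"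
    and best_response: "\<And>t \<omega>. \<omega> \<in> space (M t) \<Longrightarrow>
          is_arg_max (agent_payoff (B t \<omega>) (\<E> t) (\<gamma> t) (\<theta> t)) (\<lambda>_. True) (act t \<omega>)"
    and covariates: "\<And>t \<omega>. \<omega> \<in> space (M t) \<Longrightarrow> X t \<omega> = B t \<omega> + \<E> t *v act t \<omega>"
    and rule_range: "\<And>t x. \<delta> t x \<in> {0..1}"
    and status: "\<And>t. W t \<in> measurable (M t) (count_space {0, 1})"
    and status_bernoulli: "\<And>t. AE \<omega> in M t.
          real_cond_exp (M t) (generated_by (M t) (X t)) (\<lambda>\<omega>. indicator {1} (W t \<omega>)) \<omega>
            = \<delta> t (X t \<omega>)"
    and status_cond_indep: "\<And>t.
          cond_indep_var (M t) (generated_by (M t) (X t))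
            (count_space {0, 1}) (W t)
            (borel \<Otimes>\<^sub>M borel) (\<lambda>\<omega>. (B t \<omega>, Noise t \<omega>))"
    and outcome: "\<And>t \<omega>. \<omega> \<in> space (M t) \<Longrightarrow> Y t \<omega> = X t \<omega> \<bullet> \<theta>star + Noise t \<omega>"

definition ranking_rule ::
  "'a measure \<Rightarrow> ('a \<Rightarrow> real ^ 'm) \<Rightarrow> real ^ 'm \<Rightarrow> real ^ 'm \<Rightarrow> real" where
  "ranking_rule N X \<theta> x = cdf (distr N borel (\<lambda>\<omega>. X \<omega> \<bullet> \<theta>)) (x \<bullet> \<theta>)"

lemma agent_payoff_complete_square:
  "agent_payoff b \<E> \<gamma> \<theta> a =
     \<gamma> * (b \<bullet> \<theta>) + (norm (\<gamma> *\<^sub>R (transpose \<E> *v \<theta>)))\<^sup>2 / 2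
       - (norm (a - \<gamma> *\<^sub>R (transpose \<E> *v \<theta>)))\<^sup>2 / 2"
proof -
  define v where "v = transpose \<E> *v \<theta>"
  have "(\<E> *v a) \<bullet> \<theta> = a \<bullet> v"
    unfolding v_def by (metis dot_lmul_matrix inner_commute transpose_matrix_vector)
  then have "agent_payoff b \<E> \<gamma> \<theta> a = \<gamma> * (b \<bullet> \<theta> + a \<bullet> v) - (1/2) * (a \<bullet> a)"
    by (simp add: agent_payoff_def power2_norm_eq_inner inner_add_left)
  then show ?thesis
    unfolding v_def[symmetric] power2_norm_eq_inner
    by (simp add: inner_diff_left inner_diff_right inner_commute[of v a] field_simps)
qed

lemma agent_best_response_iff:
  "is_arg_max (agent_payoff b \<E> \<gamma> \<theta>) (\<lambda>_. True) a \<longleftrightarrow> a = \<gamma> *\<^sub>R (transpose \<E> *v \<theta>)"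
proof
  assume "is_arg_max (agent_payoff b \<E> \<gamma> \<theta>) (\<lambda>_. True) a"
  then have "agent_payoff b \<E> \<gamma> \<theta> (\<gamma> *\<^sub>R (transpose \<E> *v \<theta>)) \<le> agent_payoff b \<E> \<gamma> \<theta> a"
    by (simp add: is_arg_max_linorder)
  then show "a = \<gamma> *\<^sub>R (transpose \<E> *v \<theta>)"
    by (simp add: agent_payoff_complete_square)
next
  assume "a = \<gamma> *\<^sub>R (transpose \<E> *v \<theta>)"
  then show "is_arg_max (agent_payoff b \<E> \<gamma> \<theta>) (\<lambda>_. True) a"
    by (simp add: is_arg_max_linorder agent_payoff_complete_square)
qed

end

theory Submission
  imports Defs
begin

text \<open>
  Given the covariates, selection is independent of the baseline and the noise, so averaging the
  noise over the selected agents amounts to averaging it with weight \<open>\<delta>\<close>. Under the ranking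
  rule this weight is the rank of \<open>b \<bullet> \<theta>\<close> in the law of \<open>B \<bullet> \<theta>\<close>: the best response
  shifts every agent by the same vector, and ranks ignore common shifts. Ranks also ignore
  rescaling by \<open>k > 0\<close>, hence the mean noise of the selected agents is the same in both rounds and
  cancels.
\<close>

lemma mean_given_eq:
  fixes f :: "'a \<Rightarrow> 'b::{banach,second_countable_topology}"
  assumes "finite_measure N" and A: "A \<in> sets N" and f[measurable]: "f \<in> borel_measurable N"
  shows "mean_given N f A = (1 / measure N A) *\<^sub>R (\<integral>x. indicator A x *\<^sub>R f x \<partial>N)"
proof -
  interpret finite_measure N by fact
  note A[measurable]
  show ?thesis
  proof (cases "measure N A = 0")
    \<comment> \<open>For a null event both sides are 0: the factor \<open>1 / measure N A\<close>
      is \<open>1 / 0 = 0\<close>, and \<open>f\<close> vanishes almost everywhere on the event,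
      hence almost everywhere for the uniform measure.\<close>
    case True
    then have "AE x in N. x \<notin> A"
      using A by (intro AE_not_in) (simp add: emeasure_eq_measure null_sets_def)
    then have "AE x in N. x \<in> A \<longrightarrow> f x = 0"
      by auto
    then have "AE x in uniform_measure N A. f x = 0"
      by (rule AE_uniform_measureI[OF A])
    then have "integral\<^sup>L (uniform_measure N A) f = 0"
      by (rule integral_eq_zero_AE)
    then show ?thesis
      using True by (simp add: mean_given_def)
  next
    case False
    then have "uniform_measure N A = density N (\<lambda>x. ennreal (indicator A x / measure N A))"
      unfolding uniform_measure_def
      by (intro arg_cong[where f = "density N"] ext)
        (auto simp: emeasure_eq_measure indicator_def divide_ennreal[symmetric] zero_less_measure_iff)
    then have "mean_given N f A = (\<integral>x. (indicator A x / measure N A) *\<^sub>R f x \<partial>N)"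
      unfolding mean_given_def by (simp add: integral_density)
    also have "\<dots> = (\<integral>x. (1 / measure N A) *\<^sub>R (indicator A x *\<^sub>R f x) \<partial>N)"
      by simp
    also have "\<dots> = (1 / measure N A) *\<^sub>R (\<integral>x. indicator A x *\<^sub>R f x \<partial>N)"
      by (rule integral_scaleR_right)
    finally show ?thesis .
  qed
qed

text \<open>Averaging over an event is linear. With \<open>c\<close> the causal parameter this
  splits the outcome into a covariate part and a noise part.\<close>

lemma mean_given_inner_add:
  fixes f :: "'a \<Rightarrow> 'b::euclidean_space" and g h :: "'a \<Rightarrow> real"
  assumes N: "finite_measure N" and A[measurable]: "A \<in> sets N"
    and f: "integrable N f" and g: "integrable N g"
    and h: "\<And>x. x \<in> space N \<Longrightarrow> h x = f x \<bullet> c + g x"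
  shows "mean_given N h A = mean_given N f A \<bullet> c + mean_given N g A"
proof -
  note [measurable] = borel_measurable_integrable[OF f] borel_measurable_integrable[OF g]
  have hm: "h \<in> borel_measurable N"
    by (subst measurable_cong[OF h]) measurable
  have iA: "integrable N (\<lambda>x. indicator A x *\<^sub>R f x)" "integrable N (\<lambda>x. indicator A x *\<^sub>R g x)"
    using integrable_mult_indicator[OF A f] integrable_mult_indicator[OF A g] by auto
  have "(\<integral>x. indicator A x *\<^sub>R h x \<partial>N) =
      (\<integral>x. (indicator A x *\<^sub>R f x) \<bullet> c + indicator A x *\<^sub>R g x \<partial>N)"
    by (intro Bochner_Integration.integral_cong) (simp_all add: h algebra_simps)
  also have "\<dots> = (\<integral>x. indicator A x *\<^sub>R f x \<partial>N) \<bullet> c + (\<integral>x. indicator A x *\<^sub>R g x \<partial>N)"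
    using iA by (subst Bochner_Integration.integral_add) (simp_all del: inner_scaleR_left real_scaleR_def)
  finally show ?thesis
    unfolding mean_given_eq[OF N A hm] mean_given_eq[OF N A borel_measurable_integrable[OF f]]
      mean_given_eq[OF N A borel_measurable_integrable[OF g]]
    by (simp only: inner_scaleR_left real_scaleR_def distrib_left)
qed

text \<open>Conditional independence is given for products of indicators only. Two weighted laws of
  \<open>V\<close> are therefore compared set by set; since they coincide, they integrate every
  Borel \<open>f\<close> alike, with the same default value if \<open>f\<close> is not
  integrable.\<close>

lemma cond_indep_var_integral:
  fixes f :: "'c \<Rightarrow> real"
  assumes "prob_space N" and sub: "subalgebra N F"
    and ci: "cond_indep_var N F S U T V"
    and A[measurable]: "A \<in> sets S"
    and d[measurable]: "d \<in> borel_measurable F" and d01: "\<And>x. d x \<in> {0..1}"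
    and ce: "AE x in N. real_cond_exp N F (\<lambda>x. indicator A (U x)) x = d x"
    and f[measurable]: "f \<in> borel_measurable T"
  shows "(\<integral>x. indicator A (U x) * f (V x) \<partial>N) = (\<integral>x. d x * f (V x) \<partial>N)"
proof -
  interpret prob_space N by fact
  interpret finite_measure_subalgebra N F
    using sub by unfold_locales
  have [measurable]: "U \<in> measurable N S" "V \<in> measurable N T"
    using ci by (auto simp: cond_indep_var_def)
  have [measurable]: "d \<in> borel_measurable N"
    by (rule measurable_from_subalg[OF sub d])
  \<comment> \<open>Conditioning on \<open>F\<close> factors the product, and the first factor is
    \<open>d\<close>. As \<open>d\<close> is \<open>F\<close>-measurable, averaging then undoes the
    conditional expectation of the second factor.\<close>
  have key: "(\<integral>x. indicator A (U x) * indicator C (V x) \<partial>N) = (\<integral>x. d x * indicator C (V x) \<partial>N)"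
    if C[measurable]: "C \<in> sets T" for C
  proof -
    have int: "integrable N (\<lambda>x. indicator A (U x) * indicator C (V x) :: real)"
        "integrable N (\<lambda>x. d x * indicator C (V x))"
      using d01 by (auto intro!: integrable_const_bound[where B = 1] split: split_indicator)
    have "AE x in N. real_cond_exp N F (\<lambda>x. indicator A (U x) * indicator C (V x)) x =
        real_cond_exp N F (\<lambda>x. indicator A (U x)) x * real_cond_exp N F (\<lambda>x. indicator C (V x)) x"
      using ci A C by (auto simp: cond_indep_var_def)
    then have AE: "AE x in N. real_cond_exp N F (\<lambda>x. indicator A (U x) * indicator C (V x)) x =
        d x * real_cond_exp N F (\<lambda>x. indicator C (V x)) x"
      using ce by eventually_elim simp
    have "(\<integral>x. indicator A (U x) * indicator C (V x) \<partial>N) =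
        (\<integral>x. real_cond_exp N F (\<lambda>x. indicator A (U x) * indicator C (V x)) x \<partial>N)"
      using real_cond_exp_int(2)[OF int(1)] by simp
    also have "\<dots> = (\<integral>x. d x * real_cond_exp N F (\<lambda>x. indicator C (V x)) x \<partial>N)"
      by (rule integral_cong_AE) (use AE in simp_all)
    also have "\<dots> = (\<integral>x. d x * indicator C (V x) \<partial>N)"
      by (rule real_cond_exp_intg(2)[OF int(2)]) simp_all
    finally show ?thesis .
  qed
  \<comment> \<open>A bounded weight \<open>g\<close> on \<open>N\<close>, pushed forward along
    \<open>V\<close>; it is used for \<open>g\<close> the selection indicator and for
    \<open>g = d\<close>.\<close>
  have dens: "emeasure (distr (density N (\<lambda>x. ennreal (g x))) T V) C =
      ennreal (\<integral>x. g x * indicator C (V x) \<partial>N)"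
    if [measurable]: "g \<in> borel_measurable N" and g: "\<And>x. g x \<in> {0..1}"
      and C[measurable]: "C \<in> sets T" for g :: "'a \<Rightarrow> real" and C
  proof -
    have "emeasure (distr (density N (\<lambda>x. ennreal (g x))) T V) C =
        (\<integral>\<^sup>+x. ennreal (g x) * indicator (V -` C \<inter> space N) x \<partial>N)"
      by (subst emeasure_distr) (simp_all add: emeasure_density)
    also have "\<dots> = (\<integral>\<^sup>+x. ennreal (g x * indicator C (V x)) \<partial>N)"
      by (intro nn_integral_cong) (simp split: split_indicator)
    also have "\<dots> = ennreal (\<integral>x. g x * indicator C (V x) \<partial>N)"
      using g by (intro nn_integral_eq_integral integrable_const_bound[where B = 1])
        (auto split: split_indicator)
    finally show ?thesis .
  qed
  have "distr (density N (\<lambda>x. ennreal (indicator A (U x)))) T V =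
      distr (density N (\<lambda>x. ennreal (d x))) T V"
    using d01 by (intro measure_eqI) (simp_all add: dens key)
  then have "integral\<^sup>L (distr (density N (\<lambda>x. ennreal (indicator A (U x)))) T V) f =
      integral\<^sup>L (distr (density N (\<lambda>x. ennreal (d x))) T V) f"
    by simp
  then show ?thesis
    using d01 by (simp add: integral_distr integral_density)
qed

text \<open>A distribution function may jump, but it is monotone and therefore Borel. This makes the
  selection probability a measurable function of the covariates.\<close>

lemma borel_measurable_ranking_rule:
  assumes "finite_measure N" and [measurable]: "X \<in> borel_measurable N"
  shows "ranking_rule N X \<theta> \<in> borel_measurable borel"
proof -
  interpret finite_measure "distr N borel (\<lambda>\<omega>. X \<omega> \<bullet> \<theta>)"
    by (rule finite_measure.finite_measure_distr[OF assms(1)]) measurable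
  have "mono (cdf (distr N borel (\<lambda>\<omega>. X \<omega> \<bullet> \<theta>)))"
    by (auto simp: mono_def cdf_def intro!: finite_measure_mono)
  then have [measurable]: "cdf (distr N borel (\<lambda>\<omega>. X \<omega> \<bullet> \<theta>)) \<in> borel_measurable borel"
    by (rule borel_measurable_mono)
  show ?thesis
    unfolding ranking_rule_def[abs_def] by measurable
qed

lemma ranking_rule_eq_measure:
  assumes [measurable]: "X \<in> borel_measurable N"
  shows "ranking_rule N X \<theta> x = measure N {\<omega> \<in> space N. X \<omega> \<bullet> \<theta> \<le> x \<bullet> \<theta>}"
  unfolding ranking_rule_def cdf_def
  by (subst measure_distr) (auto intro!: arg_cong[where f = "measure N"])

text \<open>A positive factor \<open>k\<close> on both sides of the comparison of scores leaves the
  inequality unchanged.\<close>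

lemma ranking_rule_scaleR:
  assumes "X \<in> borel_measurable N" "k > 0"
  shows "ranking_rule N X (k *\<^sub>R \<theta>) = ranking_rule N X \<theta>"
  using assms by (intro ext) (simp add: ranking_rule_eq_measure)

text \<open>The shift adds \<open>c \<bullet> \<theta>\<close> to both of the compared scores and
  cancels.\<close>

lemma ranking_rule_translate:
  assumes B: "B \<in> borel_measurable N"
    and X: "\<And>\<omega>. \<omega> \<in> space N \<Longrightarrow> X \<omega> = B \<omega> + c"
  shows "ranking_rule N X \<theta> (b + c) = ranking_rule N B \<theta> b"
proof -
  note B[measurable]
  have "X \<in> borel_measurable N"
    by (subst measurable_cong[OF X]) measurable
  then show ?thesis
    by (auto simp: ranking_rule_eq_measure B X inner_add_left intro!: arg_cong[where f = "measure N"])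
qed

text \<open>A rank depends only on the law of the ranked vector, so it can be computed on the joint
  law of baseline and noise.\<close>

lemma ranking_rule_distr:
  assumes [measurable]: "V \<in> measurable N T" "X \<in> borel_measurable T"
  shows "ranking_rule (distr N T V) X \<theta> = ranking_rule N (\<lambda>\<omega>. X (V \<omega>)) \<theta>"
  unfolding ranking_rule_def[abs_def] by (simp add: distr_distr comp_def)

context strategic_selection
begin

text \<open>This space carries everything that is compared between rounds. It stays indexed by the
  round until \<open>same_law\<close> identifies its instances.\<close>

definition law :: "nat \<Rightarrow> ((real ^ 'm) \<times> real) measure" where
  "law t = distr (M t) (borel \<Otimes>\<^sub>M borel) (\<lambda>\<omega>. (B t \<omega>, Noise t \<omega>))"

text \<open>The unique best response does not involve the baseline, so all agents of a round are
  moved by one vector.\<close>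

lemma covariates_eq:
  "\<omega> \<in> space (M t) \<Longrightarrow> X t \<omega> = B t \<omega> + \<E> t *v (\<gamma> t *\<^sub>R (transpose (\<E> t) *v \<theta> t))"
  using best_response covariates by (simp add: agent_best_response_iff)

lemma measurable_baseline [measurable]: "B t \<in> borel_measurable (M t)"
  and measurable_noise [measurable]: "Noise t \<in> borel_measurable (M t)"
  using integrable_baseline integrable_noise by auto

lemma integrable_covariates: "integrable (M t) (X t)"
proof -
  interpret prob_space "M t" by (rule prob_space)
  show ?thesis
    by (subst Bochner_Integration.integrable_cong[OF refl covariates_eq])
      (auto intro: integrable_baseline)
qed

lemma sets_selected [measurable]: "{\<omega> \<in> space (M t). W t \<omega> = 1} \<in> sets (M t)"
  using measurable_sets[OF status, of "{1}" t] by (simp add: vimage_def Int_def conj_commute)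

text \<open>Selection is replaced by its conditional probability given the covariates, and this is a
  function of the baseline alone. The integral thus moves to the joint law of baseline and noise,
  where no trace of the effort remains.\<close>

lemma integral_selected_ranking:
  fixes f :: "(real ^ 'm) \<times> real \<Rightarrow> real"
  assumes rank: "\<delta> t = ranking_rule (M t) (X t) (\<theta> t)"
    and f[measurable]: "f \<in> borel_measurable (borel \<Otimes>\<^sub>M borel)"
  shows "(\<integral>\<omega>. indicator {\<omega> \<in> space (M t). W t \<omega> = 1} \<omega> * f (B t \<omega>, Noise t \<omega>) \<partial>M t) =
    (\<integral>p. ranking_rule (law t) fst (\<theta> t) (fst p) * f p \<partial>law t)"
proof -
  let ?F = "generated_by (M t) (X t)"
  have Xm: "X t \<in> borel_measurable (M t)"
    using integrable_covariates by auto
  have sub: "subalgebra (M t) ?F"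
    unfolding subalgebra_def generated_by_def
    using Xm by (auto simp: sets_vimage_algebra2 dest: measurable_sets)
  have [measurable]: "\<delta> t \<in> borel_measurable borel"
    unfolding rank by (intro borel_measurable_ranking_rule prob_space.finite_measure prob_space Xm)
  have [measurable]: "X t \<in> borel_measurable ?F"
    unfolding generated_by_def by (rule measurable_vimage_algebra1) simp
  define r where "r = ranking_rule (law t) fst (\<theta> t)"
  have "finite_measure (law t)"
    unfolding law_def
    by (intro finite_measure.finite_measure_distr prob_space.finite_measure prob_space) measurable
  then have [measurable]: "r \<in> borel_measurable borel"
    unfolding r_def by (rule borel_measurable_ranking_rule) (simp add: law_def)
  \<comment> \<open>The rank of the covariates among shifted agents equals the rank of the baseline
    among unshifted ones.\<close>
  have weight: "\<delta> t (X t \<omega>) = r (B t \<omega>)" if "\<omega> \<in> space (M t)" for \<omega>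
  proof -
    have "r = ranking_rule (M t) (B t) (\<theta> t)"
      unfolding r_def law_def by (subst ranking_rule_distr) simp_all
    then show ?thesis
      unfolding rank covariates_eq[OF that]
      by (simp only: ranking_rule_translate[OF measurable_baseline covariates_eq])
  qed
  have "(\<integral>\<omega>. indicator {\<omega> \<in> space (M t). W t \<omega> = 1} \<omega> * f (B t \<omega>, Noise t \<omega>) \<partial>M t) =
      (\<integral>\<omega>. indicator {1} (W t \<omega>) * f (B t \<omega>, Noise t \<omega>) \<partial>M t)"
    by (intro Bochner_Integration.integral_cong) (auto split: split_indicator)
  also have "\<dots> = (\<integral>\<omega>. \<delta> t (X t \<omega>) * f (B t \<omega>, Noise t \<omega>) \<partial>M t)"
    by (rule cond_indep_var_integral[OF prob_space sub status_cond_indep _ _ _ status_bernoulli])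
      (use rule_range in simp_all)
  also have "\<dots> = (\<integral>\<omega>. r (B t \<omega>) * f (B t \<omega>, Noise t \<omega>) \<partial>M t)"
    by (intro Bochner_Integration.integral_cong) (simp_all add: weight)
  also have "\<dots> = (\<integral>p. r (fst p) * f p \<partial>law t)"
    unfolding law_def by (subst integral_distr) simp_all
  finally show ?thesis
    unfolding r_def .
qed

text \<open>The previous identity gives the selection probability for \<open>f = 1\<close> and the
  weighted noise for \<open>f = snd\<close>; their quotient depends on the round only through
  \<open>law t\<close> and \<open>\<theta> t\<close>.\<close>

lemma mean_noise_selected_ranking:
  assumes rank: "\<delta> t = ranking_rule (M t) (X t) (\<theta> t)"
  shows "mean_given (M t) (Noise t) {\<omega> \<in> space (M t). W t \<omega> = 1} =
    (\<integral>p. ranking_rule (law t) fst (\<theta> t) (fst p) * snd p \<partial>law t) /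
    (\<integral>p. ranking_rule (law t) fst (\<theta> t) (fst p) \<partial>law t)"
proof -
  interpret prob_space "M t" by (rule prob_space)
  let ?A = "{\<omega> \<in> space (M t). W t \<omega> = 1}"
  have "measure (M t) ?A = (\<integral>p. ranking_rule (law t) fst (\<theta> t) (fst p) \<partial>law t)"
    using integral_selected_ranking[OF rank, of "\<lambda>_. 1"] sets.sets_into_space[OF sets_selected]
    by (simp add: Int_absorb2)
  moreover have "(\<integral>\<omega>. indicator ?A \<omega> * Noise t \<omega> \<partial>M t) =
      (\<integral>p. ranking_rule (law t) fst (\<theta> t) (fst p) * snd p \<partial>law t)"
    using integral_selected_ranking[OF rank, of snd] by simp
  ultimately show ?thesis
    by (simp add: mean_given_eq[OF finite_measure_axioms sets_selected] del: One_nat_def)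
qed

end

theorem theorem3p4:
  fixes M :: "nat \<Rightarrow> 'a measure"
    and \<theta> :: "nat \<Rightarrow> real ^ 'm"
    and \<delta> :: "nat \<Rightarrow> real ^ 'm \<Rightarrow> real"
    and B X :: "nat \<Rightarrow> 'a \<Rightarrow> real ^ 'm"
    and \<E> :: "nat \<Rightarrow> real ^ 'd ^ 'm"
    and Noise Y :: "nat \<Rightarrow> 'a \<Rightarrow> real"
    and \<gamma> :: "nat \<Rightarrow> real"
    and act :: "nat \<Rightarrow> 'a \<Rightarrow> real ^ 'd"
    and W :: "nat \<Rightarrow> 'a \<Rightarrow> nat"
    and \<theta>star :: "real ^ 'm"
    and \<E>0 :: "real ^ 'd ^ 'm"
    and \<gamma>0 k :: real
    and t t' :: nat
  assumes setting: "strategic_selection M \<theta> \<delta> B \<E> Noise \<gamma> act X W Y \<theta>star"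
    and ranking: "\<And>s. \<delta> s = ranking_rule (M s) (X s) (\<theta> s)"
    and H1: "\<And>s. \<E> s = \<E>0"
    and H2: "\<And>s. \<gamma> s = \<gamma>0" "\<gamma>0 \<ge> 0"
    and scaled: "k > 0" "\<theta> t = k *\<^sub>R \<theta> t'"
  shows "mean_given (M t) (Y t) {\<omega> \<in> space (M t). W t \<omega> = 1}
           - mean_given (M t') (Y t') {\<omega> \<in> space (M t'). W t' \<omega> = 1}
         = (mean_given (M t) (X t) {\<omega> \<in> space (M t). W t \<omega> = 1}
              - mean_given (M t') (X t') {\<omega> \<in> space (M t'). W t' \<omega> = 1}) \<bullet> \<theta>star"
proof -
  interpret strategic_selection M \<theta> \<delta> B \<E> Noise \<gamma> act X W Y \<theta>star
    by (fact setting)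
  have split: "mean_given (M s) (Y s) {\<omega> \<in> space (M s). W s \<omega> = 1} =
      mean_given (M s) (X s) {\<omega> \<in> space (M s). W s \<omega> = 1} \<bullet> \<theta>star
      + mean_given (M s) (Noise s) {\<omega> \<in> space (M s). W s \<omega> = 1}" for s
    by (intro mean_given_inner_add prob_space.finite_measure prob_space sets_selected
        integrable_covariates integrable_noise outcome)
  have law: "law t = law t'"
    unfolding law_def by (rule same_law)
  \<comment> \<open>Both the law and the rank weight now agree in the two rounds, and they determine
    the mean noise.\<close>
  have "ranking_rule (law t) fst (\<theta> t) = ranking_rule (law t') fst (\<theta> t')"
    unfolding law scaled(2) by (rule ranking_rule_scaleR) (use scaled(1) in \<open>simp_all add: law_def\<close>)
  then have "mean_given (M t) (Noise t) {\<omega> \<in> space (M t). W t \<omega> = 1} =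
      mean_given (M t') (Noise t') {\<omega> \<in> space (M t'). W t' \<omega> = 1}"
    by (simp only: mean_noise_selected_ranking[OF ranking] law)
  then show ?thesis
    unfolding split by (simp add: inner_diff_left)
qed

end
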